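(* Fix an integer $N\ge 1$ and let the error bound be fidelity-separable, i.e. $\mathcal{E}(N,\{\delta_k\}_{k=1}^N,\Theta)=\mathcal{E}_0(N,\Theta)+\sum_{k=1}^N\alpha_k(N,\Theta)\,\delta_k^p$ with $p>0$ and $\alpha_k=\alpha_k(N,\Theta)>0$. Let the per-query cost be $c(\delta)=\delta^{-\gamma}$, $\gamma>0$. Let $\varepsilon>0$ be the target accuracy and suppose $N$ is large enough that $\mathcal{E}_0(N,\Theta)\le\varepsilon-\epsilon$ for some $\epsilon>0$, where $\epsilon$ is the part of the accuracy budget allotted to the fidelity terms. Then the problem of minimizing the wall-clock time $\sum_{k=1}^N\delta_k^{-\gamma}$ over $\delta_1,\dots,\delta_N>0$ subject to $\sum_{k=1}^N\alpha_k\delta_k^p\le\epsilon$ (which implies $\mathcal{E}(N,\{\delta_k\},\Theta)\le\varepsilon$) is solved by $$\delta_i^*(N)=\left(\frac{\epsilon}{A_N}\right)^{1/p}\alpha_i(N,\Theta)^{-\frac{1}{p+\gamma}},\quad i=1,\dots,N,\qquad A_N:=\sum_{j=1}^N\alpha_j(N,\Theta)^{\frac{\gamma}{p+\gamma}},$$ and the optimal total wall-clock time is $$T_{\mathrm{total}}(N)=\epsilon^{-\gamma/p}A_N^{\frac{p+\gamma}{p}}.$$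
   Context: A zeroth-order method makes $N$ steps; at step $k$ it queries an oracle with tunable fidelity (inexactness level) $\delta_k>0$ at cost $c(\delta_k)$. The total wall-clock time is $T_{\mathrm{total}}=\sum_{k=1}^N c(\delta_k)$. The method's convergence metric is bounded by a deterministic function $\mathcal{E}(N,\{\delta_k\},\Theta)$, where $\Theta$ denotes fixed algorithmic/problem hyperparameters, and accuracy $\varepsilon$ is guaranteed once $\mathcal{E}\le\varepsilon$. *)

theory Defs
  imports "HOL-Analysis.Analysis"
begin

text \<open>
  A schedule of fidelity levels is a function \<open>\<delta> :: nat \<Rightarrow> real\<close>, of which only the entries
  \<open>\<delta> 1, \<dots>, \<delta> N\<close> are relevant for a method with \<open>N\<close> steps.
\<close>

definition positive_schedule :: "nat \<Rightarrow> (nat \<Rightarrow> real) \<Rightarrow> bool" where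
  "positive_schedule N \<delta> \<longleftrightarrow> (\<forall>k\<in>{1..N}. 0 < \<delta> k)"

definition total_time :: "(real \<Rightarrow> real) \<Rightarrow> nat \<Rightarrow> (nat \<Rightarrow> real) \<Rightarrow> real" where
  "total_time c N \<delta> = (\<Sum>k=1..N. c (\<delta> k))"

definition power_cost :: "real \<Rightarrow> real \<Rightarrow> real" where
  "power_cost \<gamma> d = d powr (-\<gamma>)"

definition fidelity_error :: "real \<Rightarrow> nat \<Rightarrow> (nat \<Rightarrow> real) \<Rightarrow> (nat \<Rightarrow> real) \<Rightarrow> real" where
  "fidelity_error p N a \<delta> = (\<Sum>k=1..N. a k * \<delta> k powr p)"

text \<open>
  Here \<open>\<alpha> k N \<Theta>\<close> is the coefficient of step \<open>k\<close>. The hyperparameters \<open>\<Theta>\<close> are left abstract,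
  and the decomposition is required at the given \<open>N\<close> and \<open>\<Theta>\<close> only.
\<close>

definition fidelity_separable ::
  "(nat \<Rightarrow> (nat \<Rightarrow> real) \<Rightarrow> 'h \<Rightarrow> real) \<Rightarrow> (nat \<Rightarrow> 'h \<Rightarrow> real) \<Rightarrow>
    (nat \<Rightarrow> nat \<Rightarrow> 'h \<Rightarrow> real) \<Rightarrow> real \<Rightarrow> nat \<Rightarrow> 'h \<Rightarrow> bool" where
  "fidelity_separable E E0 \<alpha> p N \<Theta> \<longleftrightarrow>
     (\<forall>\<delta>. positive_schedule N \<delta> \<longrightarrow>
        E N \<delta> \<Theta> = E0 N \<Theta> + fidelity_error p N (\<lambda>k. \<alpha> k N \<Theta>) \<delta>)"

definition feasible_schedules :: "real \<Rightarrow> nat \<Rightarrow> (nat \<Rightarrow> real) \<Rightarrow> real \<Rightarrow> (nat \<Rightarrow> real) set" where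
  "feasible_schedules p N a \<epsilon> = {\<delta>. positive_schedule N \<delta> \<and> fidelity_error p N a \<delta> \<le> \<epsilon>}"

definition weight_sum :: "real \<Rightarrow> real \<Rightarrow> nat \<Rightarrow> (nat \<Rightarrow> real) \<Rightarrow> real" where
  "weight_sum p \<gamma> N a = (\<Sum>j=1..N. a j powr (\<gamma> / (p + \<gamma>)))"

definition optimal_schedule ::
  "real \<Rightarrow> real \<Rightarrow> nat \<Rightarrow> (nat \<Rightarrow> real) \<Rightarrow> real \<Rightarrow> nat \<Rightarrow> real" where
  "optimal_schedule p \<gamma> N a \<epsilon> i =
     (\<epsilon> / weight_sum p \<gamma> N a) powr (1 / p) * a i powr (- 1 / (p + \<gamma>))"

end

theory Submission
  imports Defs
begin

text \<open>
  In the variables \<open>x\<^sub>k = \<delta>\<^sub>k\<^sup>p\<close> the constraint is linear and the cost \<open>x\<^sub>k powr (-\<gamma>/p)\<close> is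
  convex, so a feasible point that satisfies the Lagrange condition and exhausts the budget is a
  global minimizer. In terms of \<open>\<delta>\<close> itself, the Lagrange condition at a schedule \<open>d\<close> says that
  \<open>d\<^sub>k powr (-\<gamma>) = \<mu> * a\<^sub>k * d\<^sub>k powr p\<close> with a multiplier \<open>\<mu>\<close> common to all steps: at the optimum,
  the time spent on a step is proportional to the error that this step contributes.

  Convexity enters only as the tangent-line inequality \<open>powr_minus_ge_tangent\<close>. Summing it with the
  Lagrange condition bounds the time of every schedule from below in terms of its error
  (\<open>total_time_ge_lagrangian\<close>).

  With \<open>A = weight_sum p \<gamma> N a\<close>, the proposed schedule satisfies the condition for
  \<open>\<mu> = (\<epsilon> / A) powr (-((p + \<gamma>) / p))\<close>
  (\<open>optimal_schedule_stationary\<close>) and has error exactly \<open>\<epsilon>\<close>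
  (\<open>fidelity_error_optimal_schedule\<close>). Summing the condition over all steps then also gives the
  optimal time, as \<open>\<mu> * \<epsilon>\<close>.
\<close>

text \<open>
  With \<open>r = x / y\<close>, this is \<open>r powr (-\<gamma>) \<ge> 1 - \<gamma> / p * (r powr p - 1)\<close>, which follows from two
  applications of \<open>1 + t \<le> exp t\<close>: first \<open>r powr (-\<gamma>) \<ge> 1 - \<gamma> * ln r\<close>, then
  \<open>p * ln r \<le> r powr p - 1\<close>. The lower bound is the tangent at \<open>x = y\<close> to
  \<open>x powr (-\<gamma>)\<close> as a function of \<open>x powr p\<close>.
\<close>

lemma powr_minus_ge_tangent:
  fixes x y p \<gamma> :: real
  assumes "0 < x" "0 < y" "0 < p" "0 < \<gamma>"
  shows "y powr (-\<gamma>) * (1 - \<gamma> / p * (x powr p / y powr p - 1)) \<le> x powr (-\<gamma>)"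
proof -
  define r where "r = x / y"
  have r: "0 < r" and x: "x = y * r"
    using assms by (simp_all add: r_def)
  have "1 + p * ln r \<le> r powr p"
    using exp_ge_add_one_self[of "p * ln r"] r by (simp add: powr_def)
  then have "\<gamma> / p * (p * ln r) \<le> \<gamma> / p * (r powr p - 1)"
    using assms by (intro mult_left_mono) auto
  then have "1 - \<gamma> / p * (r powr p - 1) \<le> 1 + - \<gamma> * ln r"
    using assms by simp
  also have "\<dots> \<le> r powr (-\<gamma>)"
    using exp_ge_add_one_self[of "- \<gamma> * ln r"] r by (simp add: powr_def)
  finally have "y powr (-\<gamma>) * (1 - \<gamma> / p * (r powr p - 1)) \<le> y powr (-\<gamma>) * r powr (-\<gamma>)"
    by (intro mult_left_mono) auto
  then show ?thesis
    using assms r by (simp add: x powr_mult)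
qed

text \<open>
  Summing the tangent inequalities at a schedule \<open>d\<close>, the Lagrange condition turns the weights
  \<open>d\<^sub>k powr (-\<gamma>) / d\<^sub>k powr p\<close> of the linear terms into \<open>\<mu> * a\<^sub>k\<close>, so that these terms add up to a
  difference of errors.
\<close>

lemma total_time_ge_lagrangian:
  assumes "0 < p" "0 < \<gamma>"
    and d: "positive_schedule N d" and \<delta>: "positive_schedule N \<delta>"
    and stationary: "\<And>k. k \<in> {1..N} \<Longrightarrow> d k powr (-\<gamma>) = \<mu> * (a k * d k powr p)"
  shows "total_time (power_cost \<gamma>) N d
      - \<gamma> / p * \<mu> * (fidelity_error p N a \<delta> - fidelity_error p N a d)
    \<le> total_time (power_cost \<gamma>) N \<delta>"
proof -
  have "d k powr (-\<gamma>) - \<gamma> / p * \<mu> * (a k * \<delta> k powr p - a k * d k powr p) \<le> \<delta> k powr (-\<gamma>)"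
    if k: "k \<in> {1..N}" for k
  proof -
    have pos: "0 < d k" "0 < \<delta> k"
      using d \<delta> k by (auto simp: positive_schedule_def)
    have "d k powr (-\<gamma>) * (1 - \<gamma> / p * (\<delta> k powr p / d k powr p - 1))
        = d k powr (-\<gamma>) - \<gamma> / p * (d k powr (-\<gamma>) * (\<delta> k powr p / d k powr p - 1))"
      by (simp add: algebra_simps)
    also have "d k powr (-\<gamma>) * (\<delta> k powr p / d k powr p - 1)
        = \<mu> * (a k * \<delta> k powr p - a k * d k powr p)"
      using pos by (simp add: stationary[OF k] field_simps)
    finally show ?thesis
      using powr_minus_ge_tangent[OF pos(2,1) assms(1,2)] by (simp add: mult.assoc)
  qed
  then have "(\<Sum>k=1..N. d k powr (-\<gamma>)
      - \<gamma> / p * \<mu> * (a k * \<delta> k powr p - a k * d k powr p)) \<le> (\<Sum>k=1..N. \<delta> k powr (-\<gamma>))"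
    by (rule sum_mono)
  then show ?thesis
    by (simp only: total_time_def power_cost_def fidelity_error_def sum_subtractf
        flip: sum_distrib_left)
qed

lemma weight_sum_pos:
  assumes "1 \<le> N" "\<And>k. k \<in> {1..N} \<Longrightarrow> 0 < a k"
  shows "0 < weight_sum p \<gamma> N a"
proof -
  have "0 < a k powr (\<gamma> / (p + \<gamma>))" if "k \<in> {1..N}" for k
    using assms(2)[OF that] by simp
  then show ?thesis
    unfolding weight_sum_def using assms(1) by (intro sum_pos) auto
qed

lemma positive_schedule_optimal_schedule:
  assumes "1 \<le> N" "0 < \<epsilon>" "\<And>k. k \<in> {1..N} \<Longrightarrow> 0 < a k"
  shows "positive_schedule N (optimal_schedule p \<gamma> N a \<epsilon>)"
proof -
  have "0 < weight_sum p \<gamma> N a"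
    using assms(1,3) by (rule weight_sum_pos)
  then show ?thesis
    using assms(2) assms(3)[THEN less_imp_neq]
    by (simp add: positive_schedule_def optimal_schedule_def)
qed

lemma optimal_schedule_error_term:
  assumes "0 < p" "0 < \<gamma>" "0 < \<epsilon>" "0 < weight_sum p \<gamma> N a" "0 < a k"
  shows "a k * optimal_schedule p \<gamma> N a \<epsilon> k powr p
    = \<epsilon> / weight_sum p \<gamma> N a * a k powr (\<gamma> / (p + \<gamma>))"
proof -
  have "1 + - 1 / (p + \<gamma>) * p = \<gamma> / (p + \<gamma>)"
    using assms by (simp add: field_simps)
  then have "a k * (a k powr (- 1 / (p + \<gamma>))) powr p = a k powr (\<gamma> / (p + \<gamma>))"
    using assms by (simp add: powr_powr powr_mult_base)
  then show ?thesis
    using assms by (simp add: optimal_schedule_def powr_mult powr_powr)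
qed

text \<open>
  The factor \<open>(\<epsilon> / weight_sum p \<gamma> N a) powr (1 / p)\<close> in the schedule is the normalization that
  makes the error exhaust the budget.
\<close>

lemma fidelity_error_optimal_schedule:
  assumes "1 \<le> N" "0 < p" "0 < \<gamma>" "0 < \<epsilon>" "\<And>k. k \<in> {1..N} \<Longrightarrow> 0 < a k"
  shows "fidelity_error p N a (optimal_schedule p \<gamma> N a \<epsilon>) = \<epsilon>"
proof -
  have A: "0 < weight_sum p \<gamma> N a"
    using assms(1,5) by (rule weight_sum_pos)
  have "fidelity_error p N a (optimal_schedule p \<gamma> N a \<epsilon>)
      = (\<Sum>k=1..N. \<epsilon> / weight_sum p \<gamma> N a * a k powr (\<gamma> / (p + \<gamma>)))"
    unfolding fidelity_error_def
    using assms A by (intro sum.cong refl optimal_schedule_error_term) auto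
  also have "\<dots> = \<epsilon> / weight_sum p \<gamma> N a * weight_sum p \<gamma> N a"
    by (simp only: weight_sum_def sum_distrib_left)
  finally show ?thesis
    using A by simp
qed

text \<open>
  The exponent \<open>-1 / (p + \<gamma>)\<close> of \<open>a\<^sub>k\<close> is forced by the Lagrange condition: it makes both the cost and
  the error of step \<open>k\<close> a multiple of \<open>a\<^sub>k powr (\<gamma> / (p + \<gamma>))\<close> by a factor that does not depend on
  \<open>k\<close>.
\<close>

lemma optimal_schedule_stationary:
  assumes "0 < p" "0 < \<gamma>" "0 < \<epsilon>" "0 < weight_sum p \<gamma> N a" "0 < a k"
  shows "optimal_schedule p \<gamma> N a \<epsilon> k powr (-\<gamma>)
    = (\<epsilon> / weight_sum p \<gamma> N a) powr (-((p + \<gamma>) / p))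
      * (a k * optimal_schedule p \<gamma> N a \<epsilon> k powr p)"
proof -
  define q where "q = \<epsilon> / weight_sum p \<gamma> N a"
  have q: "0 < q"
    using assms by (simp add: q_def)
  have "1 / p * (-\<gamma>) = 1 + -((p + \<gamma>) / p)"
    using assms by (simp add: field_simps)
  then have "(q powr (1 / p)) powr (-\<gamma>) = q powr (-((p + \<gamma>) / p)) * q"
    using q by (simp only: powr_powr powr_add) simp
  moreover have "(a k powr (- 1 / (p + \<gamma>))) powr (-\<gamma>) = a k powr (\<gamma> / (p + \<gamma>))"
    by (simp add: powr_powr)
  ultimately have "optimal_schedule p \<gamma> N a \<epsilon> k powr (-\<gamma>)
      = q powr (-((p + \<gamma>) / p)) * (q * a k powr (\<gamma> / (p + \<gamma>)))"
    by (simp add: optimal_schedule_def powr_mult flip: q_def)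
  then show ?thesis
    by (simp add: optimal_schedule_error_term[OF assms] q_def)
qed

lemma total_time_optimal_schedule:
  assumes "1 \<le> N" "0 < p" "0 < \<gamma>" "0 < \<epsilon>" "\<And>k. k \<in> {1..N} \<Longrightarrow> 0 < a k"
  shows "total_time (power_cost \<gamma>) N (optimal_schedule p \<gamma> N a \<epsilon>)
    = \<epsilon> powr (- \<gamma> / p) * weight_sum p \<gamma> N a powr ((p + \<gamma>) / p)"
proof -
  have A: "0 < weight_sum p \<gamma> N a"
    using assms(1,5) by (rule weight_sum_pos)
  define \<mu> where "\<mu> = (\<epsilon> / weight_sum p \<gamma> N a) powr (-((p + \<gamma>) / p))"
  have "total_time (power_cost \<gamma>) N (optimal_schedule p \<gamma> N a \<epsilon>)
      = \<mu> * fidelity_error p N a (optimal_schedule p \<gamma> N a \<epsilon>)"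
    unfolding total_time_def power_cost_def fidelity_error_def sum_distrib_left \<mu>_def
    using assms A by (intro sum.cong refl optimal_schedule_stationary) auto
  also have "\<dots> = \<mu> * \<epsilon>"
    using fidelity_error_optimal_schedule[OF assms] by simp
  also have "\<dots> = (\<epsilon> * \<epsilon> powr (-((p + \<gamma>) / p))) * weight_sum p \<gamma> N a powr ((p + \<gamma>) / p)"
    using assms A by (simp add: \<mu>_def powr_divide powr_minus field_simps)
  also have "\<epsilon> * \<epsilon> powr (-((p + \<gamma>) / p)) = \<epsilon> powr (- \<gamma> / p)"
  proof -
    have "1 + -((p + \<gamma>) / p) = - \<gamma> / p"
      using assms by (simp add: field_simps)
    then show ?thesis
      using assms by (simp only: powr_mult_base)
  qed
  finally show ?thesis .
qed

lemma total_time_optimal_schedule_le: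
  assumes "1 \<le> N" "0 < p" "0 < \<gamma>" "0 < \<epsilon>" "\<And>k. k \<in> {1..N} \<Longrightarrow> 0 < a k"
    and \<delta>: "\<delta> \<in> feasible_schedules p N a \<epsilon>"
  shows "total_time (power_cost \<gamma>) N (optimal_schedule p \<gamma> N a \<epsilon>)
    \<le> total_time (power_cost \<gamma>) N \<delta>"
proof -
  define d where "d = optimal_schedule p \<gamma> N a \<epsilon>"
  define \<mu> where "\<mu> = (\<epsilon> / weight_sum p \<gamma> N a) powr (-((p + \<gamma>) / p))"
  have A: "0 < weight_sum p \<gamma> N a"
    using assms(1,5) by (rule weight_sum_pos)
  have "d k powr (-\<gamma>) = \<mu> * (a k * d k powr p)" if "k \<in> {1..N}" for k
    unfolding d_def \<mu>_def
    using assms A that by (intro optimal_schedule_stationary) auto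
  moreover have "positive_schedule N d"
    unfolding d_def by (rule positive_schedule_optimal_schedule[OF assms(1,4,5)])
  moreover have "positive_schedule N \<delta>"
    using \<delta> by (simp add: feasible_schedules_def)
  ultimately have "total_time (power_cost \<gamma>) N d
      - \<gamma> / p * \<mu> * (fidelity_error p N a \<delta> - fidelity_error p N a d)
    \<le> total_time (power_cost \<gamma>) N \<delta>"
    using assms(2,3) by (intro total_time_ge_lagrangian)
  moreover have "\<gamma> / p * \<mu> * (fidelity_error p N a \<delta> - fidelity_error p N a d) \<le> 0"
  proof (rule mult_nonneg_nonpos)
    show "0 \<le> \<gamma> / p * \<mu>"
      using assms(2,3) by (simp add: \<mu>_def)
    show "fidelity_error p N a \<delta> - fidelity_error p N a d \<le> 0"
      using \<delta> fidelity_error_optimal_schedule[OF assms(1-5)]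
      by (simp add: d_def feasible_schedules_def)
  qed
  ultimately show ?thesis
    by (simp add: d_def)
qed

theorem proposition1:
  fixes E :: "nat \<Rightarrow> (nat \<Rightarrow> real) \<Rightarrow> 'h \<Rightarrow> real"
    and E0 :: "nat \<Rightarrow> 'h \<Rightarrow> real"
    and \<alpha> :: "nat \<Rightarrow> nat \<Rightarrow> 'h \<Rightarrow> real"
    and \<Theta> :: 'h and N :: nat
    and p \<gamma> target \<epsilon> :: real
  defines "a \<equiv> (\<lambda>k. \<alpha> k N \<Theta>)"
  assumes "N \<ge> 1"
    and "p > 0"
    and "\<gamma> > 0"
    and "fidelity_separable E E0 \<alpha> p N \<Theta>"
    and "\<And>k. k \<in> {1..N} \<Longrightarrow> \<alpha> k N \<Theta> > 0"
    and "target > 0"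
    and "\<epsilon> > 0"
    and "E0 N \<Theta> \<le> target - \<epsilon>"
  shows "(\<forall>\<delta> \<in> feasible_schedules p N a \<epsilon>. E N \<delta> \<Theta> \<le> target) \<and>
    is_arg_min (total_time (power_cost \<gamma>) N) (\<lambda>\<delta>. \<delta> \<in> feasible_schedules p N a \<epsilon>)
      (optimal_schedule p \<gamma> N a \<epsilon>) \<and>
    total_time (power_cost \<gamma>) N (optimal_schedule p \<gamma> N a \<epsilon>) =
      \<epsilon> powr (- \<gamma> / p) * weight_sum p \<gamma> N a powr ((p + \<gamma>) / p) \<and>
    (INF \<delta> \<in> feasible_schedules p N a \<epsilon>. total_time (power_cost \<gamma>) N \<delta>) =
      \<epsilon> powr (- \<gamma> / p) * weight_sum p \<gamma> N a powr ((p + \<gamma>) / p)"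
proof -
  have a: "\<And>k. k \<in> {1..N} \<Longrightarrow> 0 < a k"
    using assms(6) by (simp add: a_def)
  let ?d = "optimal_schedule p \<gamma> N a \<epsilon>"
  have accuracy: "E N \<delta> \<Theta> \<le> target" if "\<delta> \<in> feasible_schedules p N a \<epsilon>" for \<delta>
    using that assms(5,9) by (auto simp: feasible_schedules_def fidelity_separable_def a_def)
  have feasible: "?d \<in> feasible_schedules p N a \<epsilon>"
    using positive_schedule_optimal_schedule[OF assms(2,8) a]
      fidelity_error_optimal_schedule[OF assms(2,3,4,8) a]
    by (simp add: feasible_schedules_def)
  note le = total_time_optimal_schedule_le[OF assms(2,3,4,8) a]
  note time = total_time_optimal_schedule[OF assms(2,3,4,8) a]
  have "is_arg_min (total_time (power_cost \<gamma>) N) (\<lambda>\<delta>. \<delta> \<in> feasible_schedules p N a \<epsilon>) ?d"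
    using feasible le by (auto simp: is_arg_min_linorder)
  moreover have "(INF \<delta> \<in> feasible_schedules p N a \<epsilon>. total_time (power_cost \<gamma>) N \<delta>)
      = total_time (power_cost \<gamma>) N ?d"
    using feasible le by (intro cInf_eq_minimum) auto
  ultimately show ?thesis
    using accuracy time by simp
qed

end
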